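(* Let $n\ge 1$ and let $\hat S$ be an arbitrary sampling of $[n]$. (i) (Lower bound) If $\hat S$ is not nil, i.e. $\mathbf{P}(\hat S\neq\emptyset)>0$, then $$1\le \frac{\mathbf{E}[|\hat S|^2]}{\mathbf{E}[|\hat S|]}\le \lambda'(\hat S).$$ (ii) (Upper bound) If $\tau$ is a constant such that $|\hat S|\le\tau$ with probability 1, then $\lambda'(\hat S)\le\tau$. (iii) (Identity) If $|\hat S|=\tau$ with probability 1, then $\lambda'(\hat S)=\tau$.
   Context: Let $[n]=\{1,\dots,n\}$. A sampling $\hat S$ is a random subset of $[n]$ (a random variable with values in $2^{[n]}$). Its probability matrix is the $n\times n$ matrix $P(\hat S)$ with entries $P(\hat S)_{ij}=\mathbf{P}(\{i,j\}\subseteq\hat S)$; it is positive semidefinite. For an $n\times n$ positive semidefinite matrix $M$, $\mathrm{Diag}(M)$ is the diagonal matrix containing the diagonal of $M$, and the normalized largest eigenvalue is $\lambda'(M)=\max_{h\in\mathbb{R}^n}\{h^\top M h: h^\top\mathrm{Diag}(M)h\le 1\}$. We write $\lambda'(\hat S)=\lambda'(P(\hat S))$. *)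

theory Defs
  imports "HOL-Probability.Probability"
begin

text \<open>The index set $[n]$ is the universe of a finite type \<open>'n\<close>, with $n$ its cardinality
  (which is automatically at least 1).\<close>

definition sampling :: "'a measure \<Rightarrow> ('a \<Rightarrow> 'n::finite set) \<Rightarrow> bool" where
  "sampling M S \<longleftrightarrow> prob_space M \<and> S \<in> M \<rightarrow>\<^sub>M count_space UNIV"

definition prob_matrix :: "'a measure \<Rightarrow> ('a \<Rightarrow> 'n::finite set) \<Rightarrow> real^'n^'n" where
  "prob_matrix M S = (\<chi> i j. measure M {\<omega> \<in> space M. {i, j} \<subseteq> S \<omega>})"

definition Diag :: "real^'n^'n \<Rightarrow> real^'n^'n" where
  "Diag A = (\<chi> i j. if i = j then A $ i $ j else 0)"

text \<open>\<open>GREATEST\<close> denotes a genuine maximum: its value is determined only if the maximum is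
  attained, which is the case for every positive semidefinite \<open>A\<close>. Other matrices are not
  meant as arguments.\<close>

definition lambda' :: "real^'n^'n \<Rightarrow> real" where
  "lambda' A = (GREATEST v. \<exists>h. h \<bullet> (Diag A *v h) \<le> 1 \<and> v = h \<bullet> (A *v h))"

end

theory Submission
  imports Defs
begin

text \<open>Write \<open>P\<close> for the probability matrix and \<open>p\<^sub>i = P\<^sub>i\<^sub>i\<close> for the marginals. Averaging over the
  realisations of the sampling turns both quadratic forms into expectations
  (\<open>quad_prob_matrix\<close>, \<open>quad_Diag_prob_matrix\<close>):
  \[ h^\top P h = E \Big(\sum_{i\in S} h_i\Big)^2, \qquad
     h^\top \mathrm{Diag}(P) h = E \sum_{i\in S} h_i^2 . \]

  The upper bound is then the Cauchy--Schwarz inequality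
  \<open>(\<Sum>i\<in>S. h\<^sub>i)\<^sup>2 \<le> card S * (\<Sum>i\<in>S. h\<^sub>i\<^sup>2)\<close> inside the expectation. The lower bound comes from the
  constant vector, which is the equality case of Cauchy--Schwarz for every realisation at once:
  its Rayleigh quotient is exactly \<open>E |S|\<^sup>2 / E |S|\<close>. When \<open>|S|\<close> is almost surely constant, the
  two bounds coincide.

  What needs care is that the maximum defining \<open>lambda'\<close> is attained (\<open>lambda'_attained\<close>). The
  feasible ellipsoid is unbounded in the directions \<open>i\<close> with \<open>p\<^sub>i = 0\<close>, but an element that is
  almost never sampled has a zero row and column in \<open>P\<close>, so these coordinates do not influence
  the objective and can be set to zero, which leaves a compact set.\<close>


section \<open>Attainment of the normalized largest eigenvalue\<close>

lemma quad_Diag: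
  fixes h :: "real^'n"
  shows "h \<bullet> (Diag A *v h) = (\<Sum>i\<in>UNIV. A $ i $ i * (h $ i)\<^sup>2)"
proof -
  have "(Diag A *v h) $ i = A $ i $ i * h $ i" for i
    by (simp add: matrix_vector_mult_def Diag_def if_distrib[of "\<lambda>x. x * _"] sum.delta
        cong: if_cong)
  then show ?thesis
    by (simp add: inner_vec_def power2_eq_square mult_ac)
qed

lemma quad_form:
  fixes h :: "real^'n"
  shows "h \<bullet> (A *v h) = (\<Sum>i\<in>UNIV. \<Sum>j\<in>UNIV. h $ i * h $ j * A $ i $ j)"
  by (simp add: inner_vec_def matrix_vector_mult_def sum_distrib_left mult_ac)

text \<open>Every positive semidefinite matrix satisfies the two hypotheses: its \<open>2 \<times> 2\<close> principal minors
  are nonnegative, so a vanishing diagonal entry annihilates its row and column. The maximum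
  over the possibly unbounded ellipsoid is found on the compact part of it where the coordinates
  with vanishing diagonal entry are zero.\<close>

lemma lambda'_attained:
  fixes A :: "real^'n^'n"
  assumes nonneg: "\<And>i. 0 \<le> A $ i $ i"
    and null: "\<And>i j. A $ i $ i = 0 \<or> A $ j $ j = 0 \<Longrightarrow> A $ i $ j = 0"
  obtains h where "h \<bullet> (Diag A *v h) \<le> 1" "lambda' A = h \<bullet> (A *v h)"
    "\<And>g. g \<bullet> (Diag A *v g) \<le> 1 \<Longrightarrow> g \<bullet> (A *v g) \<le> lambda' A"
proof -
  \<comment> \<open>The half-axes of the ellipsoid; since \<open>1 / 0 = 0\<close>, null coordinates get length \<open>0\<close>.\<close>
  define b :: "real^'n" where "b = (\<chi> i. 1 / sqrt (A $ i $ i))"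
  define K where "K = cbox (- b) b \<inter> {h. h \<bullet> (Diag A *v h) \<le> 1}"
  have "closed {h::real^'n. h \<bullet> (Diag A *v h) \<le> 1}"
    by (intro closed_Collect_le continuous_intros)
  then have "compact K"
    unfolding K_def by (intro compact_Int_closed compact_cbox)
  moreover have "0 \<in> K"
    using nonneg by (auto simp: K_def mem_box_cart b_def)
  moreover have "continuous_on K (\<lambda>h. h \<bullet> (A *v h))"
    by (intro continuous_intros)
  ultimately have "\<exists>h\<in>K. \<forall>g\<in>K. g \<bullet> (A *v g) \<le> h \<bullet> (A *v h)"
    using continuous_attains_sup[of K "\<lambda>h. h \<bullet> (A *v h)"] by blast
  then obtain h where h: "h \<in> K" and max: "\<And>g. g \<in> K \<Longrightarrow> g \<bullet> (A *v g) \<le> h \<bullet> (A *v h)"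
    by blast
  have bound: "g \<bullet> (A *v g) \<le> h \<bullet> (A *v h)" if g: "g \<bullet> (Diag A *v g) \<le> 1" for g
  proof -
    define g' :: "real^'n" where "g' = (\<chi> i. if A $ i $ i = 0 then 0 else g $ i)"
    have quad_eq: "g' \<bullet> (A *v g') = g \<bullet> (A *v g)"
      unfolding quad_form
    proof (intro sum.cong refl)
      show "g' $ i * g' $ j * A $ i $ j = g $ i * g $ j * A $ i $ j" for i j
      proof (cases "A $ i $ i = 0 \<or> A $ j $ j = 0")
        case True
        from null[OF this] show ?thesis by simp
      next
        case False
        then show ?thesis by (simp add: g'_def)
      qed
    qed
    have diag_eq: "g' \<bullet> (Diag A *v g') = g \<bullet> (Diag A *v g)"
      unfolding quad_Diag by (intro sum.cong refl) (auto simp: g'_def)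
    have "\<bar>g' $ i\<bar> \<le> b $ i" for i
    proof (cases "A $ i $ i = 0")
      case True
      then show ?thesis by (simp add: g'_def b_def)
    next
      case False
      then have pos: "0 < A $ i $ i"
        using nonneg[of i] by simp
      have "A $ i $ i * (g $ i)\<^sup>2 \<le> g \<bullet> (Diag A *v g)"
        unfolding quad_Diag by (rule member_le_sum) (auto simp: nonneg)
      then have "(g $ i)\<^sup>2 \<le> 1 / A $ i $ i"
        using g pos by (simp add: field_simps)
      then have "sqrt ((g $ i)\<^sup>2) \<le> sqrt (1 / A $ i $ i)"
        by (rule real_sqrt_le_mono)
      then show ?thesis
        using False by (simp add: g'_def b_def real_sqrt_divide)
    qed
    then have "g' \<in> K"
      using g diag_eq by (simp add: K_def mem_box_cart abs_le_iff minus_le_iff)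
    then show ?thesis
      using max quad_eq by metis
  qed
  have feasible: "h \<bullet> (Diag A *v h) \<le> 1"
    using h by (simp add: K_def)
  have "lambda' A = h \<bullet> (A *v h)"
    unfolding lambda'_def using feasible bound by (intro Greatest_equality) auto
  with feasible bound show ?thesis
    by (intro that) auto
qed


section \<open>Quadratic forms of the probability matrix as expectations\<close>

lemma integrable_sampling:
  fixes f :: "'n::finite set \<Rightarrow> real"
  assumes "sampling M S"
  shows "integrable M (\<lambda>\<omega>. f (S \<omega>))"
proof -
  interpret prob_space M
    using assms by (simp add: sampling_def)
  have "(\<lambda>\<omega>. f (S \<omega>)) \<in> borel_measurable M"
    using assms by (auto simp: sampling_def intro: measurable_compose)
  moreover have "\<bar>f T\<bar> \<le> (\<Sum>T\<in>UNIV. \<bar>f T\<bar>)" for T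
    by (rule member_le_sum) auto
  ultimately show ?thesis
    by (intro integrable_const_bound[where B = "\<Sum>T\<in>UNIV. \<bar>f T\<bar>"]) auto
qed

lemma prob_matrix_eq_expectation:
  assumes "sampling M S"
  shows "prob_matrix M S $ i $ j = (\<integral>\<omega>. of_bool (i \<in> S \<omega>) * of_bool (j \<in> S \<omega>) \<partial>M)"
proof -
  have "(\<integral>\<omega>. of_bool (i \<in> S \<omega>) * of_bool (j \<in> S \<omega>) \<partial>M)
      = (\<integral>\<omega>. indicat_real {\<omega> \<in> space M. {i, j} \<subseteq> S \<omega>} \<omega> \<partial>M)"
    by (intro Bochner_Integration.integral_cong) (auto simp: indicator_def)
  also have "\<dots> = prob_matrix M S $ i $ j"
    by (simp add: prob_matrix_def Int_def conj_commute)
  finally show ?thesis ..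
qed

lemma quad_prob_matrix:
  fixes S :: "'a \<Rightarrow> 'n::finite set" and h :: "real^'n"
  assumes "sampling M S"
  shows "h \<bullet> (prob_matrix M S *v h) = (\<integral>\<omega>. (\<Sum>i\<in>S \<omega>. h $ i)\<^sup>2 \<partial>M)"
proof -
  have sum_eq: "(\<Sum>i\<in>T. h $ i) = (\<Sum>i\<in>UNIV. h $ i * of_bool (i \<in> T))" for T
    by (intro sum.mono_neutral_cong_left) auto
  have "(\<Sum>i\<in>T. h $ i)\<^sup>2
      = (\<Sum>i\<in>UNIV. \<Sum>j\<in>UNIV. h $ i * h $ j * (of_bool (i \<in> T) * of_bool (j \<in> T)))" for T
    unfolding sum_eq[of T] by (simp only: power2_eq_square sum_product mult_ac)
  then have "(\<integral>\<omega>. (\<Sum>i\<in>S \<omega>. h $ i)\<^sup>2 \<partial>M) = (\<integral>\<omega>. (\<Sum>i\<in>UNIV. \<Sum>j\<in>UNIV.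
      h $ i * h $ j * (of_bool (i \<in> S \<omega>) * of_bool (j \<in> S \<omega>))) \<partial>M)"
    by presburger
  also have "\<dots> = (\<Sum>i\<in>UNIV. \<integral>\<omega>. (\<Sum>j\<in>UNIV.
      h $ i * h $ j * (of_bool (i \<in> S \<omega>) * of_bool (j \<in> S \<omega>))) \<partial>M)"
    by (intro Bochner_Integration.integral_sum integrable_sampling[OF assms])
  also have "\<dots> = (\<Sum>i\<in>UNIV. \<Sum>j\<in>UNIV. \<integral>\<omega>.
      h $ i * h $ j * (of_bool (i \<in> S \<omega>) * of_bool (j \<in> S \<omega>)) \<partial>M)"
    by (intro sum.cong refl Bochner_Integration.integral_sum integrable_sampling[OF assms])
  also have "\<dots> = h \<bullet> (prob_matrix M S *v h)"
    by (simp only: quad_form prob_matrix_eq_expectation[OF assms]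
        Bochner_Integration.integral_mult_right_zero)
  finally show ?thesis ..
qed

lemma quad_Diag_prob_matrix:
  fixes S :: "'a \<Rightarrow> 'n::finite set" and h :: "real^'n"
  assumes "sampling M S"
  shows "h \<bullet> (Diag (prob_matrix M S) *v h) = (\<integral>\<omega>. (\<Sum>i\<in>S \<omega>. (h $ i)\<^sup>2) \<partial>M)"
proof -
  have "(\<Sum>i\<in>T. (h $ i)\<^sup>2) = (\<Sum>i\<in>UNIV. of_bool (i \<in> T) * of_bool (i \<in> T) * (h $ i)\<^sup>2)" for T
    by (intro sum.mono_neutral_cong_left) auto
  then have "(\<integral>\<omega>. (\<Sum>i\<in>S \<omega>. (h $ i)\<^sup>2) \<partial>M)
      = (\<integral>\<omega>. (\<Sum>i\<in>UNIV. of_bool (i \<in> S \<omega>) * of_bool (i \<in> S \<omega>) * (h $ i)\<^sup>2) \<partial>M)"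
    by presburger
  also have "\<dots> = (\<Sum>i\<in>UNIV. \<integral>\<omega>. of_bool (i \<in> S \<omega>) * of_bool (i \<in> S \<omega>) * (h $ i)\<^sup>2 \<partial>M)"
    by (intro Bochner_Integration.integral_sum integrable_sampling[OF assms])
  also have "\<dots> = h \<bullet> (Diag (prob_matrix M S) *v h)"
    by (simp only: quad_Diag prob_matrix_eq_expectation[OF assms]
        Bochner_Integration.integral_mult_left_zero)
  finally show ?thesis ..
qed

text \<open>Monotonicity of the measure gives \<open>P\<^sub>i\<^sub>j \<le> min p\<^sub>i p\<^sub>j\<close>, so an element that is almost never sampled
  contributes a zero row and column. The hypotheses of the attainment lemma follow.\<close>

lemma lambda'_prob_matrix_attained:
  fixes S :: "'a \<Rightarrow> 'n::finite set"
  assumes "sampling M S"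
  obtains h where "h \<bullet> (Diag (prob_matrix M S) *v h) \<le> 1"
    "lambda' (prob_matrix M S) = h \<bullet> (prob_matrix M S *v h)"
    "\<And>g. g \<bullet> (Diag (prob_matrix M S) *v g) \<le> 1 \<Longrightarrow>
       g \<bullet> (prob_matrix M S *v g) \<le> lambda' (prob_matrix M S)"
proof -
  let ?P = "prob_matrix M S"
  have nonneg: "0 \<le> ?P $ i $ j" for i j
    by (simp add: prob_matrix_def)
  have le: "?P $ i $ j \<le> ?P $ i $ i" "?P $ i $ j \<le> ?P $ j $ j" for i j
    unfolding prob_matrix_eq_expectation[OF assms]
    by (intro integral_mono integrable_sampling[OF assms]; simp)+
  have null: "?P $ i $ j = 0" if "?P $ i $ i = 0 \<or> ?P $ j $ j = 0" for i j
    using that le[of i j] nonneg[of i j] by auto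
  show ?thesis
    using nonneg null that by (rule lambda'_attained)
qed

lemma lambda'_prob_matrix_ge:
  fixes S :: "'a \<Rightarrow> 'n::finite set"
  assumes "sampling M S" and "g \<bullet> (Diag (prob_matrix M S) *v g) \<le> 1"
  shows "g \<bullet> (prob_matrix M S *v g) \<le> lambda' (prob_matrix M S)"
proof -
  obtain h where "\<And>g. g \<bullet> (Diag (prob_matrix M S) *v g) \<le> 1 \<Longrightarrow>
      g \<bullet> (prob_matrix M S *v g) \<le> lambda' (prob_matrix M S)"
    by (rule lambda'_prob_matrix_attained[OF assms(1)]) (rule that)
  then show ?thesis
    using assms(2) .
qed


section \<open>Bounds on the normalized largest eigenvalue of a sampling\<close>

lemma expectation_card_pos:
  fixes S :: "'a \<Rightarrow> 'n::finite set"
  assumes "sampling M S" and "measure M {\<omega> \<in> space M. S \<omega> \<noteq> {}} > 0"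
  shows "(\<integral>\<omega>. real (card (S \<omega>)) \<partial>M) > 0"
proof -
  interpret prob_space M
    using assms by (simp add: sampling_def)
  have "measure M {\<omega> \<in> space M. S \<omega> \<noteq> {}} = (\<integral>\<omega>. of_bool (S \<omega> \<noteq> {}) \<partial>M)"
  proof -
    have "(\<integral>\<omega>. of_bool (S \<omega> \<noteq> {}) \<partial>M)
        = (\<integral>\<omega>. indicat_real {\<omega> \<in> space M. S \<omega> \<noteq> {}} \<omega> \<partial>M)"
      by (intro Bochner_Integration.integral_cong) (auto simp: indicator_def)
    then show ?thesis by (simp add: Int_def conj_commute)
  qed
  also have "\<dots> \<le> (\<integral>\<omega>. real (card (S \<omega>)) \<partial>M)"
    by (intro integral_mono integrable_sampling[OF assms(1)])
      (auto simp: of_bool_def Suc_le_eq card_gt_0_iff)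
  finally show ?thesis
    using assms(2) by linarith
qed

lemma expectation_card_le_card_squared:
  fixes S :: "'a \<Rightarrow> 'n::finite set"
  assumes "sampling M S"
  shows "(\<integral>\<omega>. real (card (S \<omega>)) \<partial>M) \<le> (\<integral>\<omega>. real (card (S \<omega>)) ^ 2 \<partial>M)"
proof (intro integral_mono integrable_sampling[OF assms])
  show "real (card (S \<omega>)) \<le> real (card (S \<omega>)) ^ 2" for \<omega>
    by (cases "card (S \<omega>)") (auto simp: power2_eq_square)
qed

text \<open>Test the maximum with the constant vector, scaled onto the boundary of the ellipsoid.\<close>

lemma lambda'_lower_bound:
  fixes S :: "'a \<Rightarrow> 'n::finite set"
  assumes S: "sampling M S" and pos: "(\<integral>\<omega>. real (card (S \<omega>)) \<partial>M) > 0"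
  shows "(\<integral>\<omega>. real (card (S \<omega>)) ^ 2 \<partial>M) / (\<integral>\<omega>. real (card (S \<omega>)) \<partial>M)
           \<le> lambda' (prob_matrix M S)"
proof -
  let ?E = "\<integral>\<omega>. real (card (S \<omega>)) \<partial>M"
  define c where "c = 1 / sqrt ?E"
  define g :: "real^'n" where "g = (\<chi> i. c)"
  have c: "c\<^sup>2 = 1 / ?E"
    using pos by (simp add: c_def power_divide)
  have "g \<bullet> (Diag (prob_matrix M S) *v g) = ?E * c\<^sup>2"
    using S by (simp add: quad_Diag_prob_matrix g_def)
  then have "g \<bullet> (Diag (prob_matrix M S) *v g) \<le> 1"
    using pos c by simp
  then have "g \<bullet> (prob_matrix M S *v g) \<le> lambda' (prob_matrix M S)"
    by (rule lambda'_prob_matrix_ge[OF S])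
  moreover have "g \<bullet> (prob_matrix M S *v g) = (\<integral>\<omega>. real (card (S \<omega>)) ^ 2 \<partial>M) * c\<^sup>2"
    using S by (simp add: quad_prob_matrix g_def power_mult_distrib)
  ultimately show ?thesis
    using c by simp
qed

lemma lambda'_upper_bound:
  fixes S :: "'a \<Rightarrow> 'n::finite set" and \<tau> :: real
  assumes S: "sampling M S" and le: "AE \<omega> in M. real (card (S \<omega>)) \<le> \<tau>"
  shows "lambda' (prob_matrix M S) \<le> \<tau>"
proof -
  interpret prob_space M
    using S by (simp add: sampling_def)
  \<comment> \<open>Scaling by \<open>\<tau>\<close> in the last step needs its sign, which is forced because the bound holds at
     some outcome.\<close>
  have "AE \<omega> in M. 0 \<le> \<tau>"
    using le by eventually_elim (rule order_trans[OF of_nat_0_le_iff])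
  then have "0 \<le> \<tau>"
    by simp
  obtain h where feasible: "h \<bullet> (Diag (prob_matrix M S) *v h) \<le> 1"
    and h: "lambda' (prob_matrix M S) = h \<bullet> (prob_matrix M S *v h)"
    by (rule lambda'_prob_matrix_attained[OF S]) (rule that)
  have "lambda' (prob_matrix M S) = (\<integral>\<omega>. (\<Sum>i\<in>S \<omega>. h $ i)\<^sup>2 \<partial>M)"
    using h quad_prob_matrix[OF S] by simp
  also have "\<dots> \<le> (\<integral>\<omega>. \<tau> * (\<Sum>i\<in>S \<omega>. (h $ i)\<^sup>2) \<partial>M)"
  proof (intro integral_mono_AE integrable_sampling[OF S])
    show "AE \<omega> in M. (\<Sum>i\<in>S \<omega>. h $ i)\<^sup>2 \<le> \<tau> * (\<Sum>i\<in>S \<omega>. (h $ i)\<^sup>2)"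
      using le
    proof eventually_elim
      case (elim \<omega>)
      have "(\<Sum>i\<in>S \<omega>. h $ i)\<^sup>2 \<le> real (card (S \<omega>)) * (\<Sum>i\<in>S \<omega>. (h $ i)\<^sup>2)"
        using Cauchy_Schwarz_ineq_sum[of "\<lambda>_. 1" "\<lambda>i. h $ i" "S \<omega>"] by simp
      also have "\<dots> \<le> \<tau> * (\<Sum>i\<in>S \<omega>. (h $ i)\<^sup>2)"
        by (intro mult_right_mono elim sum_nonneg) simp
      finally show ?case .
    qed
  qed
  also have "\<dots> = \<tau> * (h \<bullet> (Diag (prob_matrix M S) *v h))"
    using S by (simp add: quad_Diag_prob_matrix)
  also have "\<dots> \<le> \<tau> * 1"
    using feasible \<open>0 \<le> \<tau>\<close> by (intro mult_left_mono)
  finally show ?thesis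
    by simp
qed

text \<open>For \<open>\<tau> > 0\<close> the lower bound reads \<open>\<tau>\<^sup>2 / \<tau> = \<tau>\<close>. The sampling that is almost surely empty has
  no such quotient; there the zero vector witnesses \<open>lambda' \<ge> 0\<close>.\<close>

lemma lambda'_eq_of_constant_card:
  fixes S :: "'a \<Rightarrow> 'n::finite set" and \<tau> :: real
  assumes S: "sampling M S" and eq: "AE \<omega> in M. real (card (S \<omega>)) = \<tau>"
  shows "lambda' (prob_matrix M S) = \<tau>"
proof (rule antisym)
  interpret prob_space M
    using S by (simp add: sampling_def)
  show "lambda' (prob_matrix M S) \<le> \<tau>"
    using S eq by (intro lambda'_upper_bound) auto
  have E1: "(\<integral>\<omega>. real (card (S \<omega>)) \<partial>M) = (\<integral>\<omega>. \<tau> \<partial>M)"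
    using eq
    by (intro integral_cong_AE borel_measurable_integrable[OF integrable_sampling[OF S]]) auto
  have E2: "(\<integral>\<omega>. real (card (S \<omega>)) ^ 2 \<partial>M) = (\<integral>\<omega>. \<tau> ^ 2 \<partial>M)"
    using eq
    by (intro integral_cong_AE borel_measurable_integrable[OF integrable_sampling[OF S]]) auto
  show "\<tau> \<le> lambda' (prob_matrix M S)"
  proof (cases "\<tau> > 0")
    case True
    then show ?thesis
      using lambda'_lower_bound[OF S] E1 E2 by (simp add: prob_space power2_eq_square)
  next
    case False
    have "(0::real^'n) \<bullet> (prob_matrix M S *v 0) \<le> lambda' (prob_matrix M S)"
      by (rule lambda'_prob_matrix_ge[OF S]) simp
    then show ?thesis
      using False by simp
  qed
qed

theorem theorem4p1:
  fixes M :: "'a measure" and S :: "'a \<Rightarrow> 'n::finite set"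
  assumes "sampling M S"
  shows "(measure M {\<omega> \<in> space M. S \<omega> \<noteq> {}} > 0 \<longrightarrow>
            1 \<le> (\<integral>\<omega>. real (card (S \<omega>)) ^ 2 \<partial>M) / (\<integral>\<omega>. real (card (S \<omega>)) \<partial>M) \<and>
            (\<integral>\<omega>. real (card (S \<omega>)) ^ 2 \<partial>M) / (\<integral>\<omega>. real (card (S \<omega>)) \<partial>M)
              \<le> lambda' (prob_matrix M S)) \<and>
         (\<forall>\<tau>::real. (AE \<omega> in M. real (card (S \<omega>)) \<le> \<tau>) \<longrightarrow> lambda' (prob_matrix M S) \<le> \<tau>) \<and>
         (\<forall>\<tau>::real. (AE \<omega> in M. real (card (S \<omega>)) = \<tau>) \<longrightarrow> lambda' (prob_matrix M S) = \<tau>)"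
proof (intro conjI impI allI)
  assume "measure M {\<omega> \<in> space M. S \<omega> \<noteq> {}} > 0"
  then have pos: "(\<integral>\<omega>. real (card (S \<omega>)) \<partial>M) > 0"
    by (rule expectation_card_pos[OF assms])
  show "1 \<le> (\<integral>\<omega>. real (card (S \<omega>)) ^ 2 \<partial>M) / (\<integral>\<omega>. real (card (S \<omega>)) \<partial>M)"
    using pos expectation_card_le_card_squared[OF assms] by simp
  show "(\<integral>\<omega>. real (card (S \<omega>)) ^ 2 \<partial>M) / (\<integral>\<omega>. real (card (S \<omega>)) \<partial>M)
          \<le> lambda' (prob_matrix M S)"
    by (rule lambda'_lower_bound[OF assms pos])
qed (auto intro: lambda'_upper_bound[OF assms] lambda'_eq_of_constant_card[OF assms])

end
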